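(* Let $d\ge1$, let $\mathcal{X},\mathcal{Y}_1,\dots,\mathcal{Y}_d$ be Banach spaces over $\mathbb{F}$, and let $\mathcal{T}=(T_1,\dots,T_d)$ and $\mathcal{S}=(S_1,\dots,S_d)$ belong to $\mathcal{L}(\mathcal{X},\ell_\infty^d(\mathcal{Y}_k))$. Then $\mathcal{T}\perp_B\mathbb{F}^d\mathcal{S}$ if and only if there exists $1\le i\le d$ such that $T_i\perp_B S_i$ and $\|T_i\|=\|\mathcal{T}\|$.
   Context: $\mathbb{F}$ is $\mathbb{R}$ or $\mathbb{C}$. $\ell_\infty^d(\mathcal{Y}_k)$ is the direct sum $\mathcal{Y}_1\oplus\cdots\oplus\mathcal{Y}_d$ with norm $\|(y_1,\dots,y_d)\|_\infty=\max_{1\le i\le d}\|y_i\|$. $\mathcal{L}(\mathcal{X},\mathcal{Y})$ is the space of bounded linear operators from $\mathcal{X}$ to $\mathcal{Y}$ with the operator norm. A tuple $\mathcal{T}=(T_1,\dots,T_d)$ with $T_k\in\mathcal{L}(\mathcal{X},\mathcal{Y}_k)$ is identified with the operator $x\mapsto(T_1x,\dots,T_dx)$ into $\ell_\infty^d(\mathcal{Y}_k)$, and $\|\mathcal{T}\|$ is its operator norm. For $\mathbf{z}=(z_1,\dots,z_d)\in\mathbb{F}^d$, $\mathbf{z}\mathcal{S}=(z_1S_1,\dots,z_dS_d)$, and $\mathbb{F}^d\mathcal{S}=\{\mathbf{z}\mathcal{S}:\mathbf{z}\in\mathbb{F}^d\}$. Birkhoff-James orthogonality: for elements $x,y$ of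 a Banach space, $x\perp_B y$ means $\|x+\lambda y\|\ge\|x\|$ for all $\lambda\in\mathbb{F}$; for a subspace $W$, $x\perp_B W$ means $x\perp_B w$ for all $w\in W$. *)

theory Defs
  imports "HOL-Analysis.Abstract_Metric_Spaces" "HOL-Algebra.Module"
begin

text \<open>The spaces \<open>Y 1, \<dots>, Y d\<close> of a tuple are different spaces, so a normed space is a
  carrier-based module (with a norm) over a scalar field \<open>F\<close>. The scalars are complex numbers,
  and \<open>F\<close> is \<open>\<real>\<close> or \<open>UNIV\<close>; for \<open>F = \<real>\<close> the scalar multiplication is relevant only at real
  scalars. A family \<open>Y :: nat \<Rightarrow> 'b normed_module\<close> of spaces with carriers inside one type \<open>'b\<close>
  is no restriction, because finitely many carriers always embed in a common type.\<close>

definition scalars :: "complex set \<Rightarrow> complex ring" where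
  "scalars F = \<lparr>carrier = F, mult = (*), one = 1, zero = 0, add = (+)\<rparr>"

record 'a normed_module = "(complex, 'a) module" +
  vnorm :: "'a \<Rightarrow> real" (\<open>\<parallel>_\<parallel>\<index>\<close>)

locale normed_space = module "scalars F" X
  for F :: "complex set" and X :: "'a normed_module" (structure) +
  assumes vnorm_nonneg: "x \<in> carrier X \<Longrightarrow> 0 \<le> \<parallel>x\<parallel>"
    and vnorm_eq_0_iff: "x \<in> carrier X \<Longrightarrow> \<parallel>x\<parallel> = 0 \<longleftrightarrow> x = \<zero>\<^bsub>X\<^esub>"
    and vnorm_smult: "\<lbrakk>a \<in> F; x \<in> carrier X\<rbrakk> \<Longrightarrow> \<parallel>a \<odot>\<^bsub>X\<^esub> x\<parallel> = cmod a * \<parallel>x\<parallel>"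
    and vnorm_triangle:
      "\<lbrakk>x \<in> carrier X; y \<in> carrier X\<rbrakk> \<Longrightarrow> \<parallel>x \<oplus>\<^bsub>X\<^esub> y\<parallel> \<le> \<parallel>x\<parallel> + \<parallel>y\<parallel>"

text \<open>\<^locale>\<open>Metric_space\<close> requires nonnegativity and symmetry outside the carrier as well, hence
  the conditional.\<close>

definition vdist :: "'a normed_module \<Rightarrow> 'a \<Rightarrow> 'a \<Rightarrow> real" where
  "vdist X x y = (if x \<in> carrier X \<and> y \<in> carrier X then \<parallel>x \<ominus>\<^bsub>X\<^esub> y\<parallel>\<^bsub>X\<^esub> else 0)"

locale banach_space = normed_space +
  assumes complete: "Metric_space.mcomplete (carrier X) (vdist X)"

text \<open>Operators and tuples are extensional functions, so that they are equal when they agree on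
  the carrier or on the index set. The fields \<open>mult\<close> and \<open>one\<close>, inherited from rings, play no
  role in modules.\<close>

definition linf :: "nat \<Rightarrow> (nat \<Rightarrow> 'b normed_module) \<Rightarrow> (nat \<Rightarrow> 'b) normed_module" where
  "linf d Y =
    \<lparr>carrier = (\<Pi>\<^sub>E k\<in>{1..d}. carrier (Y k)),
     mult = undefined, one = undefined,
     zero = (\<lambda>k\<in>{1..d}. \<zero>\<^bsub>Y k\<^esub>),
     add = (\<lambda>x y. \<lambda>k\<in>{1..d}. x k \<oplus>\<^bsub>Y k\<^esub> y k),
     smult = (\<lambda>a x. \<lambda>k\<in>{1..d}. a \<odot>\<^bsub>Y k\<^esub> x k),
     vnorm = (\<lambda>x. Max ((\<lambda>k. \<parallel>x k\<parallel>\<^bsub>Y k\<^esub>) ` {1..d}))\<rparr>"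

definition bounded_ops ::
  "complex set \<Rightarrow> 'a normed_module \<Rightarrow> 'b normed_module \<Rightarrow> ('a \<Rightarrow> 'b) normed_module" where
  "bounded_ops F X Y =
    \<lparr>carrier = {T \<in> carrier X \<rightarrow>\<^sub>E carrier Y.
       (\<forall>x\<in>carrier X. \<forall>y\<in>carrier X. T (x \<oplus>\<^bsub>X\<^esub> y) = T x \<oplus>\<^bsub>Y\<^esub> T y) \<and>
       (\<forall>a\<in>F. \<forall>x\<in>carrier X. T (a \<odot>\<^bsub>X\<^esub> x) = a \<odot>\<^bsub>Y\<^esub> T x) \<and>
       (\<exists>C. \<forall>x\<in>carrier X. \<parallel>T x\<parallel>\<^bsub>Y\<^esub> \<le> C * \<parallel>x\<parallel>\<^bsub>X\<^esub>)},
     mult = undefined, one = undefined,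
     zero = (\<lambda>x\<in>carrier X. \<zero>\<^bsub>Y\<^esub>),
     add = (\<lambda>S T. \<lambda>x\<in>carrier X. S x \<oplus>\<^bsub>Y\<^esub> T x),
     smult = (\<lambda>a T. \<lambda>x\<in>carrier X. a \<odot>\<^bsub>Y\<^esub> T x),
     vnorm = (\<lambda>T. SUP x\<in>{x \<in> carrier X. \<parallel>x\<parallel>\<^bsub>X\<^esub> \<le> 1}. \<parallel>T x\<parallel>\<^bsub>Y\<^esub>)\<rparr>"

text \<open>The operator into \<open>linf d Y\<close> with which a tuple of operators is identified.\<close>

definition op_tuple :: "'a normed_module \<Rightarrow> nat \<Rightarrow> (nat \<Rightarrow> 'a \<Rightarrow> 'b) \<Rightarrow> 'a \<Rightarrow> nat \<Rightarrow> 'b" where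
  "op_tuple X d T = (\<lambda>x\<in>carrier X. \<lambda>k\<in>{1..d}. T k x)"

definition scalar_multiples ::
  "complex set \<Rightarrow> 'a normed_module \<Rightarrow> nat \<Rightarrow> (nat \<Rightarrow> 'b normed_module) \<Rightarrow>
    (nat \<Rightarrow> 'a \<Rightarrow> 'b) \<Rightarrow> ('a \<Rightarrow> nat \<Rightarrow> 'b) set" where
  "scalar_multiples F X d Y S =
    {op_tuple X d (\<lambda>k. z k \<odot>\<^bsub>bounded_ops F X (Y k)\<^esub> S k) | z. z \<in> {1..d} \<rightarrow>\<^sub>E F}"

definition bj_orth :: "complex set \<Rightarrow> 'a normed_module \<Rightarrow> 'a \<Rightarrow> 'a \<Rightarrow> bool" where
  "bj_orth F X x y \<longleftrightarrow> (\<forall>a\<in>F. \<parallel>x \<oplus>\<^bsub>X\<^esub> a \<odot>\<^bsub>X\<^esub> y\<parallel>\<^bsub>X\<^esub> \<ge> \<parallel>x\<parallel>\<^bsub>X\<^esub>)"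

definition bj_orth_set :: "complex set \<Rightarrow> 'a normed_module \<Rightarrow> 'a \<Rightarrow> 'a set \<Rightarrow> bool" where
  "bj_orth_set F X x W \<longleftrightarrow> (\<forall>w\<in>W. bj_orth F X x w)"

end

theory Submission
  imports Defs
begin

text \<open>The norm of a tuple of operators is the largest norm of its components
  (\<open>norm_op_tuple\<close>), and \<open>\<T> + a(\<z>\<S>)\<close> is the tuple of the operators \<open>T\<^sub>k + (a z\<^sub>k)S\<^sub>k\<close>
  (\<open>add_smult_op_tuple\<close>).

  If \<open>T\<^sub>i \<perp>\<^sub>B S\<^sub>i\<close> at an index with \<open>\<parallel>T\<^sub>i\<parallel> = \<parallel>\<T>\<parallel>\<close>, then the \<open>i\<close>-th component alone keeps the norm
  of \<open>\<T> + a(\<z>\<S>)\<close> from falling below \<open>\<parallel>\<T>\<parallel>\<close>. If there is no such index, then each component can be brought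
  strictly below \<open>\<parallel>\<T>\<parallel>\<close> separately: by \<open>z\<^sub>k = 0\<close> where \<open>\<parallel>T\<^sub>k\<parallel> < \<parallel>\<T>\<parallel>\<close>, and elsewhere by a \<open>z\<^sub>k\<close>
  with \<open>\<parallel>T\<^sub>k + z\<^sub>kS\<^sub>k\<parallel> < \<parallel>T\<^sub>k\<parallel>\<close>. The scalars \<open>z\<^sub>k\<close> are independent of each other, so the
  \<open>\<z>\<close> assembled from them satisfies \<open>\<parallel>\<T> + \<z>\<S>\<parallel> < \<parallel>\<T>\<parallel>\<close>, a maximum of finitely many numbers
  below \<open>\<parallel>\<T>\<parallel>\<close>.\<close>

text \<open>Boundedness of each \<open>f k\<close> matters because the supremum of an unbounded set of reals
  is an unspecified value.\<close>

lemma SUP_Max_swap: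
  fixes f :: "'k \<Rightarrow> 'x \<Rightarrow> real"
  assumes "finite I" "I \<noteq> {}" "A \<noteq> {}"
    and bdd: "\<And>k. k \<in> I \<Longrightarrow> bdd_above (f k ` A)"
  shows "(SUP x\<in>A. Max ((\<lambda>k. f k x) ` I)) = Max ((\<lambda>k. SUP x\<in>A. f k x) ` I)"
proof (rule antisym)
  have upper: "Max ((\<lambda>k. f k x) ` I) \<le> Max ((\<lambda>k. SUP x\<in>A. f k x) ` I)" if "x \<in> A" for x
  proof -
    have "f k x \<le> Max ((\<lambda>k. SUP x\<in>A. f k x) ` I)" if "k \<in> I" for k
    proof -
      have "f k x \<le> (SUP x\<in>A. f k x)"
        using cSUP_upper[OF \<open>x \<in> A\<close> bdd[OF \<open>k \<in> I\<close>]] .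
      also have "\<dots> \<le> Max ((\<lambda>k. SUP x\<in>A. f k x) ` I)"
        using \<open>finite I\<close> \<open>k \<in> I\<close> by (intro Max_ge) auto
      finally show ?thesis .
    qed
    then show ?thesis
      using \<open>finite I\<close> \<open>I \<noteq> {}\<close> by simp
  qed
  then show "(SUP x\<in>A. Max ((\<lambda>k. f k x) ` I)) \<le> Max ((\<lambda>k. SUP x\<in>A. f k x) ` I)"
    using \<open>A \<noteq> {}\<close> by (intro cSUP_least)
  have bdd_Max: "bdd_above ((\<lambda>x. Max ((\<lambda>k. f k x) ` I)) ` A)"
    using upper by (intro bdd_aboveI2)
  have "(SUP x\<in>A. f k x) \<le> (SUP x\<in>A. Max ((\<lambda>k. f k x) ` I))" if "k \<in> I" for k
    using \<open>A \<noteq> {}\<close> bdd_Max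
  proof (rule cSUP_mono)
    show "\<exists>y\<in>A. f k x \<le> Max ((\<lambda>k. f k y) ` I)" if "x \<in> A" for x
      using \<open>x \<in> A\<close> \<open>k \<in> I\<close> \<open>finite I\<close> by (intro bexI[of _ x] Max_ge) auto
  qed
  then show "Max ((\<lambda>k. SUP x\<in>A. f k x) ` I) \<le> (SUP x\<in>A. Max ((\<lambda>k. f k x) ` I))"
    using \<open>finite I\<close> \<open>I \<noteq> {}\<close> by simp
qed

definition unit_ball :: "'a normed_module \<Rightarrow> 'a set" where
  "unit_ball X = {x \<in> carrier X. \<parallel>x\<parallel>\<^bsub>X\<^esub> \<le> 1}"

lemma unit_ball_nonempty:
  assumes "normed_space F X"
  shows "unit_ball X \<noteq> {}"
proof -
  interpret normed_space F X by fact
  have "\<zero>\<^bsub>X\<^esub> \<in> unit_ball X"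
    using vnorm_eq_0_iff[of "\<zero>\<^bsub>X\<^esub>"] by (simp add: unit_ball_def)
  then show ?thesis by blast
qed

lemma op_norm_eq_SUP: "\<parallel>U\<parallel>\<^bsub>bounded_ops F X Y\<^esub> = (SUP x\<in>unit_ball X. \<parallel>U x\<parallel>\<^bsub>Y\<^esub>)"
  by (simp add: bounded_ops_def unit_ball_def)

lemma bounded_ops_in_carrier:
  assumes "U \<in> carrier (bounded_ops F X Y)" and "x \<in> carrier X"
  shows "U x \<in> carrier Y"
  using assms by (auto simp: bounded_ops_def)

lemma add_smult_op:
  assumes "x \<in> carrier X"
  shows "(U \<oplus>\<^bsub>bounded_ops F X Y\<^esub> a \<odot>\<^bsub>bounded_ops F X Y\<^esub> V) x = U x \<oplus>\<^bsub>Y\<^esub> a \<odot>\<^bsub>Y\<^esub> V x"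
  using assms by (simp add: bounded_ops_def)

text \<open>Boundedness on the unit ball is what makes the supremum in \<open>op_norm_eq_SUP\<close> meaningful.\<close>

lemma bdd_above_bounded_op:
  assumes "normed_space F X" and U: "U \<in> carrier (bounded_ops F X Y)"
  shows "bdd_above ((\<lambda>x. \<parallel>U x\<parallel>\<^bsub>Y\<^esub>) ` unit_ball X)"
proof -
  interpret X: normed_space F X by fact
  obtain C where C: "\<And>x. x \<in> carrier X \<Longrightarrow> \<parallel>U x\<parallel>\<^bsub>Y\<^esub> \<le> C * \<parallel>x\<parallel>\<^bsub>X\<^esub>"
    using U unfolding bounded_ops_def by simp blast
  have "\<parallel>U x\<parallel>\<^bsub>Y\<^esub> \<le> \<bar>C\<bar>" if "x \<in> unit_ball X" for x
  proof -
    have x: "x \<in> carrier X" "\<parallel>x\<parallel>\<^bsub>X\<^esub> \<le> 1"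
      using that by (auto simp: unit_ball_def)
    have "\<parallel>U x\<parallel>\<^bsub>Y\<^esub> \<le> C * \<parallel>x\<parallel>\<^bsub>X\<^esub>"
      using C x by blast
    also have "\<dots> \<le> \<bar>C\<bar> * 1"
      using x X.vnorm_nonneg by (intro mult_mono) auto
    finally show ?thesis by simp
  qed
  then show ?thesis
    by (intro bdd_aboveI2)
qed

lemma bdd_above_add_smult:
  assumes X: "normed_space F X" and "normed_space F Y" and "a \<in> F"
    and U: "U \<in> carrier (bounded_ops F X Y)" and V: "V \<in> carrier (bounded_ops F X Y)"
  shows "bdd_above ((\<lambda>x. \<parallel>(U \<oplus>\<^bsub>bounded_ops F X Y\<^esub> a \<odot>\<^bsub>bounded_ops F X Y\<^esub> V) x\<parallel>\<^bsub>Y\<^esub>) ` unit_ball X)"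
proof -
  interpret Y: normed_space F Y by fact
  obtain B D where
    B: "\<And>x. x \<in> unit_ball X \<Longrightarrow> \<parallel>U x\<parallel>\<^bsub>Y\<^esub> \<le> B" and
    D: "\<And>x. x \<in> unit_ball X \<Longrightarrow> \<parallel>V x\<parallel>\<^bsub>Y\<^esub> \<le> D"
    using bdd_above_bounded_op[OF X U] bdd_above_bounded_op[OF X V]
    by (auto simp: bdd_above_def)
  have "\<parallel>(U \<oplus>\<^bsub>bounded_ops F X Y\<^esub> a \<odot>\<^bsub>bounded_ops F X Y\<^esub> V) x\<parallel>\<^bsub>Y\<^esub> \<le> B + cmod a * D"
    if "x \<in> unit_ball X" for x
  proof -
    have x: "x \<in> carrier X"
      using that by (simp add: unit_ball_def)
    have mem: "U x \<in> carrier Y" "V x \<in> carrier Y" "a \<odot>\<^bsub>Y\<^esub> V x \<in> carrier Y"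
      using bounded_ops_in_carrier[OF U x] bounded_ops_in_carrier[OF V x] \<open>a \<in> F\<close>
      by (auto simp: scalars_def intro!: Y.smult_closed)
    have "\<parallel>U x \<oplus>\<^bsub>Y\<^esub> a \<odot>\<^bsub>Y\<^esub> V x\<parallel>\<^bsub>Y\<^esub> \<le> \<parallel>U x\<parallel>\<^bsub>Y\<^esub> + cmod a * \<parallel>V x\<parallel>\<^bsub>Y\<^esub>"
      using Y.vnorm_triangle[OF mem(1,3)] Y.vnorm_smult[OF \<open>a \<in> F\<close> mem(2)] by simp
    also have "\<dots> \<le> B + cmod a * D"
      using B D that by (intro add_mono mult_left_mono) auto
    finally show ?thesis
      using x by (simp add: add_smult_op)
  qed
  then show ?thesis
    by (intro bdd_aboveI2)
qed

lemma add_zero_smult_op: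
  assumes "normed_space F Y"
    and U: "U \<in> carrier (bounded_ops F X Y)" and V: "V \<in> carrier (bounded_ops F X Y)"
  shows "U \<oplus>\<^bsub>bounded_ops F X Y\<^esub> 0 \<odot>\<^bsub>bounded_ops F X Y\<^esub> V = U"
proof -
  interpret Y: normed_space F Y by fact
  show ?thesis
  proof (rule extensionalityI[of _ "carrier X"])
    show "U \<oplus>\<^bsub>bounded_ops F X Y\<^esub> 0 \<odot>\<^bsub>bounded_ops F X Y\<^esub> V \<in> extensional (carrier X)"
      by (simp add: bounded_ops_def)
    show "U \<in> extensional (carrier X)"
      using U by (auto simp: bounded_ops_def PiE_def)
    fix x assume x: "x \<in> carrier X"
    show "(U \<oplus>\<^bsub>bounded_ops F X Y\<^esub> 0 \<odot>\<^bsub>bounded_ops F X Y\<^esub> V) x = U x"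
      using Y.smult_l_null[OF bounded_ops_in_carrier[OF V x]] bounded_ops_in_carrier[OF U x]
      by (simp add: add_smult_op x scalars_def)
  qed
qed

text \<open>The norm of the tuple is a supremum over the unit ball of maxima over the components. The
  components are assumed bounded on the unit ball because this is the form in which
  \<open>bdd_above_add_smult\<close> makes the lemma applicable to perturbed operators \<open>T\<^sub>k + aS\<^sub>k\<close>.\<close>

lemma norm_op_tuple:
  assumes X: "normed_space F X" and "d \<ge> 1"
    and bdd: "\<And>k. k \<in> {1..d} \<Longrightarrow> bdd_above ((\<lambda>x. \<parallel>U k x\<parallel>\<^bsub>Y k\<^esub>) ` unit_ball X)"
  shows "\<parallel>op_tuple X d U\<parallel>\<^bsub>bounded_ops F X (linf d Y)\<^esub>
    = Max ((\<lambda>k. \<parallel>U k\<parallel>\<^bsub>bounded_ops F X (Y k)\<^esub>) ` {1..d})"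
proof -
  have "\<parallel>op_tuple X d U x\<parallel>\<^bsub>linf d Y\<^esub> = Max ((\<lambda>k. \<parallel>U k x\<parallel>\<^bsub>Y k\<^esub>) ` {1..d})"
    if "x \<in> unit_ball X" for x
    using that by (simp add: op_tuple_def linf_def unit_ball_def cong: image_cong_simp)
  then show ?thesis
    using SUP_Max_swap[of "{1..d}" "unit_ball X" "\<lambda>k x. \<parallel>U k x\<parallel>\<^bsub>Y k\<^esub>"]
      unit_ball_nonempty[OF X] bdd \<open>d \<ge> 1\<close>
    by (simp add: op_norm_eq_SUP cong: SUP_cong)
qed

lemma add_smult_op_tuple:
  assumes Y: "\<And>k. k \<in> {1..d} \<Longrightarrow> normed_space F (Y k)"
    and "a \<in> F" and z: "\<And>k. k \<in> {1..d} \<Longrightarrow> z k \<in> F"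
    and S: "\<And>k. k \<in> {1..d} \<Longrightarrow> S k \<in> carrier (bounded_ops F X (Y k))"
  shows "op_tuple X d T \<oplus>\<^bsub>bounded_ops F X (linf d Y)\<^esub>
      a \<odot>\<^bsub>bounded_ops F X (linf d Y)\<^esub> op_tuple X d (\<lambda>k. z k \<odot>\<^bsub>bounded_ops F X (Y k)\<^esub> S k)
    = op_tuple X d (\<lambda>k. T k \<oplus>\<^bsub>bounded_ops F X (Y k)\<^esub> (a * z k) \<odot>\<^bsub>bounded_ops F X (Y k)\<^esub> S k)"
    (is "?L = ?R")
proof -
  have assoc: "(a * z k) \<odot>\<^bsub>Y k\<^esub> S k x = a \<odot>\<^bsub>Y k\<^esub> (z k \<odot>\<^bsub>Y k\<^esub> S k x)"
    if "k \<in> {1..d}" "x \<in> carrier X" for k x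
  proof -
    interpret Yk: normed_space F "Y k" by (rule Y) fact
    show ?thesis
      using Yk.smult_assoc1[of a "z k" "S k x"] \<open>a \<in> F\<close> z[OF that(1)]
        bounded_ops_in_carrier[OF S[OF that(1)] that(2)]
      by (simp add: scalars_def)
  qed
  have "?L x k = ?R x k" for x k
    using assoc[of k x] by (auto simp: op_tuple_def bounded_ops_def linf_def restrict_def)
  then show ?thesis by blast
qed

theorem corollary2p12:
  fixes F :: "complex set" and d :: nat
    and X :: "'a normed_module" and Y :: "nat \<Rightarrow> 'b normed_module"
    and T S :: "nat \<Rightarrow> 'a \<Rightarrow> 'b"
  assumes "F = \<real> \<or> F = UNIV"
    and "d \<ge> 1"
    and "banach_space F X"
    and "\<And>k. k \<in> {1..d} \<Longrightarrow> banach_space F (Y k)"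
    and "\<And>k. k \<in> {1..d} \<Longrightarrow> T k \<in> carrier (bounded_ops F X (Y k))"
    and "\<And>k. k \<in> {1..d} \<Longrightarrow> S k \<in> carrier (bounded_ops F X (Y k))"
  shows "bj_orth_set F (bounded_ops F X (linf d Y)) (op_tuple X d T) (scalar_multiples F X d Y S)
    \<longleftrightarrow> (\<exists>i\<in>{1..d}. bj_orth F (bounded_ops F X (Y i)) (T i) (S i) \<and>
          \<parallel>T i\<parallel>\<^bsub>bounded_ops F X (Y i)\<^esub> = \<parallel>op_tuple X d T\<parallel>\<^bsub>bounded_ops F X (linf d Y)\<^esub>)"
proof -
  have F: "0 \<in> F" "1 \<in> F" "\<And>a b. a \<in> F \<Longrightarrow> b \<in> F \<Longrightarrow> a * b \<in> F"
    using assms(1) by auto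
  have X: "normed_space F X" and Y: "\<And>k. k \<in> {1..d} \<Longrightarrow> normed_space F (Y k)"
    using assms(3,4) by (simp_all add: banach_space_def)
  define N where "N = \<parallel>op_tuple X d T\<parallel>\<^bsub>bounded_ops F X (linf d Y)\<^esub>"
  define P where "P k a = \<parallel>T k \<oplus>\<^bsub>bounded_ops F X (Y k)\<^esub> a \<odot>\<^bsub>bounded_ops F X (Y k)\<^esub> S k\<parallel>\<^bsub>bounded_ops F X (Y k)\<^esub>"
    for k a
  have N: "N = Max ((\<lambda>k. \<parallel>T k\<parallel>\<^bsub>bounded_ops F X (Y k)\<^esub>) ` {1..d})"
    unfolding N_def using X assms(2) bdd_above_bounded_op[OF X assms(5)] by (rule norm_op_tuple)
  have perturbed: "\<parallel>op_tuple X d T \<oplus>\<^bsub>bounded_ops F X (linf d Y)\<^esub> a \<odot>\<^bsub>bounded_ops F X (linf d Y)\<^esub>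
      op_tuple X d (\<lambda>k. z k \<odot>\<^bsub>bounded_ops F X (Y k)\<^esub> S k)\<parallel>\<^bsub>bounded_ops F X (linf d Y)\<^esub>
    = Max ((\<lambda>k. P k (a * z k)) ` {1..d})"
    if a: "a \<in> F" and "z \<in> {1..d} \<rightarrow>\<^sub>E F" for a z
  proof -
    have z: "\<And>k. k \<in> {1..d} \<Longrightarrow> z k \<in> F"
      using that(2) by auto
    have "\<parallel>op_tuple X d (\<lambda>k. T k \<oplus>\<^bsub>bounded_ops F X (Y k)\<^esub> (a * z k) \<odot>\<^bsub>bounded_ops F X (Y k)\<^esub> S k)\<parallel>\<^bsub>bounded_ops F X (linf d Y)\<^esub>
      = Max ((\<lambda>k. P k (a * z k)) ` {1..d})"
      unfolding P_def using X assms(2)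
      by (rule norm_op_tuple) (intro bdd_above_add_smult X Y F(3) a z assms(5,6))
    then show ?thesis
      using add_smult_op_tuple[of d F Y a z S X T, OF Y a z assms(6)] by presburger
  qed
  have orth_iff: "bj_orth_set F (bounded_ops F X (linf d Y)) (op_tuple X d T) (scalar_multiples F X d Y S)
    \<longleftrightarrow> (\<forall>z \<in> {1..d} \<rightarrow>\<^sub>E F. \<forall>a\<in>F. N \<le> Max ((\<lambda>k. P k (a * z k)) ` {1..d}))"
    (is "?orth \<longleftrightarrow> _")
    unfolding bj_orth_set_def scalar_multiples_def bj_orth_def N_def[symmetric]
    by (simp only: setcompr_eq_image Collect_mem_eq ball_simps perturbed cong: ball_cong)
  show ?thesis
    unfolding N_def[symmetric]
  proof
    assume orth: ?orth
    show "\<exists>i\<in>{1..d}. bj_orth F (bounded_ops F X (Y i)) (T i) (S i) \<and> \<parallel>T i\<parallel>\<^bsub>bounded_ops F X (Y i)\<^esub> = N"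
    proof (rule ccontr)
      assume none: "\<not> ?thesis"
      \<comment> \<open>The scalar found here depends on \<open>k\<close>; this is where orthogonality to independently scaled
        components of \<open>\<S>\<close> is used, rather than only to \<open>\<S>\<close> itself.\<close>
      have "\<exists>a\<in>F. P k a < N" if k: "k \<in> {1..d}" for k
      proof (cases "\<parallel>T k\<parallel>\<^bsub>bounded_ops F X (Y k)\<^esub> = N")
        case True
        then show ?thesis
          using none k by (auto simp: bj_orth_def P_def not_le)
      next
        case False
        moreover have "\<parallel>T k\<parallel>\<^bsub>bounded_ops F X (Y k)\<^esub> \<le> N"
          unfolding N using k by (intro Max_ge) auto
        ultimately have "P k 0 < N"
          using add_zero_smult_op[OF Y[OF k] assms(5)[OF k] assms(6)[OF k]] by (simp add: P_def)
        then show ?thesis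
          using F(1) by blast
      qed
      then obtain w where w: "\<And>k. k \<in> {1..d} \<Longrightarrow> w k \<in> F \<and> P k (w k) < N"
        by metis
      define z where "z = restrict w {1..d}"
      have z: "z \<in> {1..d} \<rightarrow>\<^sub>E F" and P: "\<And>k. k \<in> {1..d} \<Longrightarrow> P k (1 * z k) < N"
        using w by (auto simp: z_def)
      have "N \<le> Max ((\<lambda>k. P k (1 * z k)) ` {1..d})"
        using orth z F(2) unfolding orth_iff by blast
      also have "\<dots> < N"
        using P assms(2) by (subst Max_less_iff) auto
      finally show False by simp
    qed
  next
    assume "\<exists>i\<in>{1..d}. bj_orth F (bounded_ops F X (Y i)) (T i) (S i) \<and> \<parallel>T i\<parallel>\<^bsub>bounded_ops F X (Y i)\<^esub> = N"
    then obtain i where i: "i \<in> {1..d}" and orth: "\<And>a. a \<in> F \<Longrightarrow> N \<le> P i a"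
      by (auto simp: bj_orth_def P_def)
    have "N \<le> Max ((\<lambda>k. P k (a * z k)) ` {1..d})" if "a \<in> F" and z: "z \<in> {1..d} \<rightarrow>\<^sub>E F" for a z
    proof -
      have "N \<le> P i (a * z i)"
        using i that by (intro orth F(3)) auto
      also have "\<dots> \<le> Max ((\<lambda>k. P k (a * z k)) ` {1..d})"
        using i by (intro Max_ge) auto
      finally show ?thesis .
    qed
    then show ?orth
      unfolding orth_iff by blast
  qed
qed

end
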